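(* Let $\mathcal{T}$ be a single-path loop as described in the context which is monotonic, and let $x[\vec r] \in \mathcal{L}$ be displacing. Suppose that for each lvalue $\ell \in \mathit{Lval}(\vec r)$ a closed form $\ell^{(n)}$ is given, and let $\vec r^{(n)} := \vec r[\ell/\ell^{(n)} \mid \ell \in \mathit{Lval}(\vec r)]$. Then $x[\vec r]^{(n)} := x[\vec r^{(n)}]$ is a closed form for $x[\vec r]$, i.e., $x[\vec r^{(n)}] = \mathsf{up}^n(x[\vec r])$ holds for all $n \in \mathbb{N}$.
   Context: Variables and arrays: $\mathcal{V}$ is a countably infinite set of variables, each $x \in \mathcal{V}$ having an arity $\mathsf{arity}(x) \in \mathbb{N}$; $x$ denotes a function $\mathbb{Z}^{\mathsf{arity}(x)} \to \mathbb{Z}$ (arity $0$ means scalar; $i[\,]$ is written $i$). Rvalues: $r ::= c \mid r \circ r \mid x[r_1,\ldots,r_k]$ with $c \in \mathbb{Z}$, $\circ$ an arithmetic operator, $k = \mathsf{arity}(x)$. An lvalue is an rvalue of the form $x[\vec r]$. $\mathit{Lval}(r)$ is the set of top-level lvalues of $r$: $\{r\}$ if $r$ is an lvalue, $\mathit{Lval}(r_1)\cup\mathit{Lval}(r_2)$ if $r=r_1\circ r_2$, $\emptyset$ if $r\in\mathbb{Z}$; for vectors take the union. Expressions may also contain if-then-else and $\lambda$-array expressions; states assign functions to variables, and an equation "holds" (is valid) if it is true in every state. Loop $\mathcal{T}$: $\mathbf{while}\ \phi\ \mathbf{do}\ (\ell_1,\ldots,\ell_m)\leftarrow(r_1,\ldots,r_m)$,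 $\phi$ a conjunction of (in)equations over rvalues, $\ell_j = x_j[\vec r_j]$ lvalues with $x_i \neq x_j$ or $\vec r_i \neq \vec r_j$ for $i\neq j$, simultaneous update; $\vec\ell=(\ell_1,\ldots,\ell_m)$, $\mathsf{rhs}(x_j[\vec r_j]) := r_j$. Update: $\mathsf{up}_x(\text{empty}) = x$; $\mathsf{up}_x(x[\vec r],\vec\ell') = \lambda\vec i.\ \mathbf{if}\ \vec i=\vec r\ \mathbf{then}\ \mathsf{rhs}(x[\vec r])\ \mathbf{else}\ \mathsf{up}_x(\vec\ell')[\vec i]$ ($\vec i$ fresh); $\mathsf{up}_x(y[\vec r],\vec\ell') = \mathsf{up}_x(\vec\ell')$ for $y\neq x$. $\mathsf{up}$ is the substitution $[x/\mathsf{up}_x(\vec\ell)\mid x\in\mathcal{V}]$ (applied componentwise to vectors), $\mathsf{up}^n$ its $n$-fold iteration. Order and monotonicity: vectors of equal length are compared lexicographically ($\vec r<\vec r'$ iff some $i$ has $r_i<r'_i$ and $r_j=r'_j$ for $j<i$; two empty vectors are equal). The paper assumes throughout that monotonic loops are increasing: $\mathcal{T}$ is monotonic if for every $x\in\mathcal{V}$ the formula $\bigwedge_{x[\vec r]\in\vec\ell} \vec r \le \mathsf{up}(\vec r)$ is valid. Relevant lvalues: $\mathcal{L}$ is the smallest set with $\mathit{Lval}(r_j)\subseteq\mathcal{L}$ for all $j$ and with $x[\vec r]\in\mathcal{L} \Rightarrow \mathit{Lval}(\vec r)\subseteq\mathcal{L}$. An lvalue $x[\vec r]\in\mathcal{L}$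 is displacing if for all $\vec r'$ with $x[\vec r']\in\vec\ell$, $\vec r' < \mathsf{up}(\vec r)$ is valid. Closed form: for a fresh scalar variable $n$, an expression $\ell^{(n)}$ over $\mathcal{V}\cup\{n\}$ is a closed form for the lvalue $\ell$ if $\ell^{(n)} = \mathsf{up}^n(\ell)$ holds for all $n\in\mathbb{N}$. *)

theory Defs
  imports "HOL-Library.List_Lexorder" "HOL-Library.Countable"
begin

text \<open>
  Throughout, \<open>'v\<close> is the type of variables, whose arities are given by a function
  \<open>'v \<Rightarrow> nat\<close>. A binary operator is represented by its integer semantics, so no particular
  signature of arithmetic operators is fixed.
\<close>

datatype 'v rval =
    Lit int
  | Bin "int \<Rightarrow> int \<Rightarrow> int" "'v rval" "'v rval"
  | Acc 'v "'v rval list"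

text \<open>The pair \<open>(x, rs)\<close> stands for the lvalue \<open>Acc x rs\<close>, i.e. for \<open>x[rs]\<close>.\<close>

type_synonym 'v lval = "'v \<times> 'v rval list"

fun wf_rval :: "('v \<Rightarrow> nat) \<Rightarrow> 'v rval \<Rightarrow> bool" where
  "wf_rval ar (Lit c) = True"
| "wf_rval ar (Bin f r1 r2) = (wf_rval ar r1 \<and> wf_rval ar r2)"
| "wf_rval ar (Acc x rs) = (length rs = ar x \<and> (\<forall>r\<in>set rs. wf_rval ar r))"

text \<open>Only top-level lvalues are collected: there is no descent into index vectors.\<close>

fun Lval :: "'v rval \<Rightarrow> 'v lval set" where
  "Lval (Lit c) = {}"
| "Lval (Bin f r1 r2) = Lval r1 \<union> Lval r2"
| "Lval (Acc x rs) = {(x, rs)}"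

definition Lvals :: "'v rval list \<Rightarrow> 'v lval set" where
  "Lvals rs = (\<Union>r\<in>set rs. Lval r)"


datatype cmp = EQ | NE | LT | LE | GT | GE

fun cmp_sem :: "cmp \<Rightarrow> int \<Rightarrow> int \<Rightarrow> bool" where
  "cmp_sem EQ a b = (a = b)"
| "cmp_sem NE a b = (a \<noteq> b)"
| "cmp_sem LT a b = (a < b)"
| "cmp_sem LE a b = (a \<le> b)"
| "cmp_sem GT a b = (a > b)"
| "cmp_sem GE a b = (a \<ge> b)"

text \<open>
  Expressions use de Bruijn indices: \<open>ELam k e\<close> is the array expression \<open>\<lambda>i\<^sub>0,\<dots>,i\<^sub>k\<^sub>-\<^sub>1. e\<close>, and
  \<open>EBound d p\<close> refers to component \<open>p\<close> of the index vector bound by the \<open>d\<close>-th enclosing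
  \<open>ELam\<close>, counted from the inside.
\<close>

datatype 'v exp =
    ELit int
  | EBin "int \<Rightarrow> int \<Rightarrow> int" "'v exp" "'v exp"
  | EIte "'v cond" "'v exp" "'v exp"
  | EBound nat nat
  | ESel "'v arr" "'v exp list"
and 'v arr =
    EVar 'v
  | ELam nat "'v exp"
and 'v cond =
    CCmp cmp "'v exp" "'v exp"
  | CConj "'v cond list"
  | CNot "'v cond"

text \<open>The list argument contains the arities of the enclosing binders, innermost first.\<close>

fun wf_exp :: "('v \<Rightarrow> nat) \<Rightarrow> nat list \<Rightarrow> 'v exp \<Rightarrow> bool"
and wf_arr :: "('v \<Rightarrow> nat) \<Rightarrow> nat list \<Rightarrow> nat \<Rightarrow> 'v arr \<Rightarrow> bool"
and wf_cond :: "('v \<Rightarrow> nat) \<Rightarrow> nat list \<Rightarrow> 'v cond \<Rightarrow> bool" where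
  "wf_exp ar ks (ELit c) = True"
| "wf_exp ar ks (EBin f e1 e2) = (wf_exp ar ks e1 \<and> wf_exp ar ks e2)"
| "wf_exp ar ks (EIte b e1 e2) = (wf_cond ar ks b \<and> wf_exp ar ks e1 \<and> wf_exp ar ks e2)"
| "wf_exp ar ks (EBound d p) = (d < length ks \<and> p < ks ! d)"
| "wf_exp ar ks (ESel a es) = (wf_arr ar ks (length es) a \<and> (\<forall>e\<in>set es. wf_exp ar ks e))"
| "wf_arr ar ks n (EVar x) = (n = ar x)"
| "wf_arr ar ks n (ELam k e) = (n = k \<and> wf_exp ar (k # ks) e)"
| "wf_cond ar ks (CCmp c e1 e2) = (wf_exp ar ks e1 \<and> wf_exp ar ks e2)"
| "wf_cond ar ks (CConj bs) = (\<forall>b\<in>set bs. wf_cond ar ks b)"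
| "wf_cond ar ks (CNot b) = wf_cond ar ks b"

text \<open>
  A value of a variable of arity \<open>k\<close> is a function on integer lists, of which only the
  restriction to lists of length \<open>k\<close> is ever used in well-formed expressions.
\<close>

type_synonym 'v state = "'v \<Rightarrow> int list \<Rightarrow> int"

fun eval_exp :: "'v state \<Rightarrow> int list list \<Rightarrow> 'v exp \<Rightarrow> int"
and eval_arr :: "'v state \<Rightarrow> int list list \<Rightarrow> 'v arr \<Rightarrow> int list \<Rightarrow> int"
and eval_cond :: "'v state \<Rightarrow> int list list \<Rightarrow> 'v cond \<Rightarrow> bool" where
  "eval_exp s env (ELit c) = c"
| "eval_exp s env (EBin f e1 e2) = f (eval_exp s env e1) (eval_exp s env e2)"
| "eval_exp s env (EIte b e1 e2) =
     (if eval_cond s env b then eval_exp s env e1 else eval_exp s env e2)"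
| "eval_exp s env (EBound d p) = env ! d ! p"
| "eval_exp s env (ESel a es) = eval_arr s env a (map (eval_exp s env) es)"
| "eval_arr s env (EVar x) is = s x is"
| "eval_arr s env (ELam k e) is = eval_exp s (is # env) e"
| "eval_cond s env (CCmp c e1 e2) = cmp_sem c (eval_exp s env e1) (eval_exp s env e2)"
| "eval_cond s env (CConj bs) = (\<forall>b\<in>set bs. eval_cond s env b)"
| "eval_cond s env (CNot b) = (\<not> eval_cond s env b)"

abbreviation evals :: "'v state \<Rightarrow> 'v exp list \<Rightarrow> int list" where
  "evals s es \<equiv> map (eval_exp s []) es"

text \<open>
  Simultaneous substitution of closed array expressions for variables. As the substituted
  expressions have no free bound indices, nothing has to be lifted below \<open>ELam\<close>.
\<close>

fun subst_exp :: "('v \<Rightarrow> 'w arr) \<Rightarrow> 'v exp \<Rightarrow> 'w exp"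
and subst_arr :: "('v \<Rightarrow> 'w arr) \<Rightarrow> 'v arr \<Rightarrow> 'w arr"
and subst_cond :: "('v \<Rightarrow> 'w arr) \<Rightarrow> 'v cond \<Rightarrow> 'w cond" where
  "subst_exp \<sigma> (ELit c) = ELit c"
| "subst_exp \<sigma> (EBin f e1 e2) = EBin f (subst_exp \<sigma> e1) (subst_exp \<sigma> e2)"
| "subst_exp \<sigma> (EIte b e1 e2) = EIte (subst_cond \<sigma> b) (subst_exp \<sigma> e1) (subst_exp \<sigma> e2)"
| "subst_exp \<sigma> (EBound d p) = EBound d p"
| "subst_exp \<sigma> (ESel a es) = ESel (subst_arr \<sigma> a) (map (subst_exp \<sigma>) es)"
| "subst_arr \<sigma> (EVar x) = \<sigma> x"
| "subst_arr \<sigma> (ELam k e) = ELam k (subst_exp \<sigma> e)"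
| "subst_cond \<sigma> (CCmp c e1 e2) = CCmp c (subst_exp \<sigma> e1) (subst_exp \<sigma> e2)"
| "subst_cond \<sigma> (CConj bs) = CConj (map (subst_cond \<sigma>) bs)"
| "subst_cond \<sigma> (CNot b) = CNot (subst_cond \<sigma> b)"

fun exp_of :: "'v rval \<Rightarrow> 'v exp" where
  "exp_of (Lit c) = ELit c"
| "exp_of (Bin f r1 r2) = EBin f (exp_of r1) (exp_of r2)"
| "exp_of (Acc x rs) = ESel (EVar x) (map exp_of rs)"

abbreviation exp_of_lval :: "'v lval \<Rightarrow> 'v exp" where
  "exp_of_lval l \<equiv> exp_of (Acc (fst l) (snd l))"

text \<open>The guard is a conjunction, given as the list of its conjuncts.\<close>

record 'v loop =
  guard :: "(cmp \<times> 'v rval \<times> 'v rval) list"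
  assigns :: "('v lval \<times> 'v rval) list"

abbreviation lvalues :: "'v loop \<Rightarrow> 'v lval list" where
  "lvalues T \<equiv> map fst (assigns T)"

definition wf_loop :: "('v \<Rightarrow> nat) \<Rightarrow> 'v loop \<Rightarrow> bool" where
  "wf_loop ar T \<longleftrightarrow>
     (\<forall>(c, r1, r2) \<in> set (guard T). wf_rval ar r1 \<and> wf_rval ar r2) \<and>
     (\<forall>((x, rs), r) \<in> set (assigns T). wf_rval ar (Acc x rs) \<and> wf_rval ar r) \<and>
     distinct (lvalues T)"

text \<open>The body reads \<open>if i = rs then r else up\<^sub>x(as)[i]\<close>, with \<open>i\<close> the bound index vector.\<close>

fun up_var :: "'v \<Rightarrow> ('v lval \<times> 'v rval) list \<Rightarrow> 'v arr" where
  "up_var x [] = EVar x"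
| "up_var x (((y, rs), r) # as) =
     (if y = x
      then let k = length rs in
        ELam k (EIte (CConj (map (\<lambda>p. CCmp EQ (EBound 0 p) (exp_of (rs ! p))) [0..<k]))
                     (exp_of r)
                     (ESel (up_var x as) (map (EBound 0) [0..<k])))
      else up_var x as)"

definition up :: "'v loop \<Rightarrow> 'v exp \<Rightarrow> 'v exp" where
  "up T = subst_exp (\<lambda>x. up_var x (assigns T))"

text \<open>
  The order on vectors is the lexicographic list order of the library, which is only ever
  used here on lists of equal length.
\<close>

definition monotonic :: "'v loop \<Rightarrow> bool" where
  "monotonic T \<longleftrightarrow>
     (\<forall>x. \<forall>s. \<forall>rs. (x, rs) \<in> set (lvalues T) \<longrightarrow>
        evals s (map exp_of rs) \<le> evals s (map (up T \<circ> exp_of) rs))"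

inductive_set relevant :: "'v loop \<Rightarrow> 'v lval set" for T :: "'v loop" where
  rhs: "(l, r) \<in> set (assigns T) \<Longrightarrow> l' \<in> Lval r \<Longrightarrow> l' \<in> relevant T"
| index: "(x, rs) \<in> relevant T \<Longrightarrow> l' \<in> Lvals rs \<Longrightarrow> l' \<in> relevant T"

definition displacing :: "'v loop \<Rightarrow> 'v lval \<Rightarrow> bool" where
  "displacing T = (\<lambda>(x, rs). (x, rs) \<in> relevant T \<and>
     (\<forall>rs'. (x, rs') \<in> set (lvalues T) \<longrightarrow>
        (\<forall>s. evals s (map exp_of rs') < evals s (map (up T \<circ> exp_of) rs))))"

text \<open>
  Expressions over the variables and one additional fresh scalar variable \<open>n\<close> are
  expressions over \<open>'v option\<close>, where \<open>None\<close> is \<open>n\<close>.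
\<close>

definition arity_n :: "('v \<Rightarrow> nat) \<Rightarrow> 'v option \<Rightarrow> nat" where
  "arity_n ar = case_option 0 ar"

definition state_n :: "'v state \<Rightarrow> nat \<Rightarrow> 'v option state" where
  "state_n s n = case_option (\<lambda>_. int n) s"

definition closed_form :: "('v \<Rightarrow> nat) \<Rightarrow> 'v loop \<Rightarrow> 'v option exp \<Rightarrow> 'v lval \<Rightarrow> bool" where
  "closed_form ar T e l \<longleftrightarrow>
     wf_exp (arity_n ar) [] e \<and>
     (\<forall>n s. eval_exp (state_n s n) [] e = eval_exp s [] ((up T ^^ n) (exp_of_lval l)))"

text \<open>Simultaneous replacement of the top-level lvalues of an rvalue.\<close>

fun replace_lvals :: "('v lval \<Rightarrow> 'v option exp) \<Rightarrow> 'v rval \<Rightarrow> 'v option exp" where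
  "replace_lvals cf (Lit c) = ELit c"
| "replace_lvals cf (Bin f r1 r2) = EBin f (replace_lvals cf r1) (replace_lvals cf r2)"
| "replace_lvals cf (Acc x rs) = cf (x, rs)"

end

theory Submission
  imports Defs
begin

text \<open>
  Semantically, applying \<open>up\<close> to an expression means evaluating it after one step of the loop.
  Let \<open>s\<^sub>k\<close> be the state after \<open>k\<close> steps from \<open>s\<close>. By monotonicity and since \<open>x[rs]\<close> is
  displacing, the value of \<open>rs\<close> in \<open>s\<^sub>n\<close> exceeds every index written to in \<open>x\<close> by one of the
  steps from \<open>s\<^sub>0\<close> to \<open>s\<^sub>n\<close>, so \<open>x\<close> still has its initial value there.
\<close>

definition step :: "'v loop \<Rightarrow> 'v state \<Rightarrow> 'v state" where
  "step T s = (\<lambda>x. eval_arr s [] (up_var x (assigns T)))"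

lemma eval_exp_of_env: "eval_exp s env (exp_of r) = eval_exp s [] (exp_of r)"
  by (induction r) (simp_all cong: map_cong)

text \<open>The array is closed: \<open>EBound 0 p\<close> refers to its own \<open>ELam\<close>,
  and rvalues contain no bound indices. Each recursive occurrence lies below one more binder, so
  \<open>env\<close> must be general.\<close>

lemma eval_up_var_env: "eval_arr s env (up_var x as) is = eval_arr s [] (up_var x as) is"
proof (induction x as arbitrary: env "is" rule: up_var.induct)
  case (2 x y rs r as)
  let ?env = "is # env" and ?env' = "[is]"
  have rec: "eval_arr s ?env (up_var x as) js = eval_arr s ?env' (up_var x as) js"
    if "y = x" for js
    using 2(1)[OF that refl, of ?env js] 2(1)[OF that refl, of ?env' js] by simp
  show ?case
  proof (cases "y = x")
    case True
    then show ?thesis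
      using rec[OF True] eval_exp_of_env[of s ?env] eval_exp_of_env[of s ?env']
      by (simp add: Let_def comp_def)
  next
    case False
    then show ?thesis
      using 2(2)[OF False, of env] by simp
  qed
qed simp

text \<open>The environment grows below \<open>ELam\<close>; \<open>closed\<close> says that the
  substituted arrays ignore it, so substituting amounts to changing the state.\<close>

lemma eval_subst:
  assumes closed: "\<And>x env. eval_arr s env (\<sigma> x) = eval_arr s [] (\<sigma> x)"
  shows eval_subst_exp:
      "eval_exp s env (subst_exp \<sigma> e) = eval_exp (\<lambda>x. eval_arr s [] (\<sigma> x)) env e"
    and eval_subst_arr:
      "eval_arr s env (subst_arr \<sigma> a) is = eval_arr (\<lambda>x. eval_arr s [] (\<sigma> x)) env a is"
    and eval_subst_cond:
      "eval_cond s env (subst_cond \<sigma> b) = eval_cond (\<lambda>x. eval_arr s [] (\<sigma> x)) env b"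
proof (induction e and a and b arbitrary: env and env "is" and env)
  case (EVar x)
  show ?case by (simp add: closed[of env])
qed (simp_all add: comp_def cong: map_cong)

lemma eval_up: "eval_exp s env (up T e) = eval_exp (step T s) env e"
  unfolding up_def step_def by (rule eval_subst_exp) (rule ext, rule eval_up_var_env)

lemma eval_up_funpow: "eval_exp s env ((up T ^^ n) e) = eval_exp ((step T ^^ n) s) env e"
  \<comment> \<open>The outermost \<open>up\<close> yields the first step from \<open>s\<close>,
    whereas the outermost \<open>step\<close> is the last one; \<open>funpow_swap1\<close>
    reconciles the two orders.\<close>
  by (induction n arbitrary: s) (simp_all add: eval_up funpow_swap1[of "step T"])

lemma eval_up_var_unchanged:
  assumes "\<And>rs. (x, rs) \<in> fst ` set as \<Longrightarrow>
      length rs = length is \<and> evals s (map exp_of rs) \<noteq> is"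
  shows "eval_arr s env (up_var x as) is = s x is"
  using assms
proof (induction x as arbitrary: env rule: up_var.induct)
  case (2 x y rs r as)
  have rec: "eval_arr s env (up_var x as) is = s x is" for env
    using 2 by (cases "y = x") auto
  show ?case
  proof (cases "y = x")
    case True
    have len: "length rs = length is" and neq: "evals s (map exp_of rs) \<noteq> is"
      using 2(3) True by auto
    obtain p where p: "p < length rs" "eval_exp s [] (exp_of (rs ! p)) \<noteq> is ! p"
      using len neq by (auto simp: list_eq_iff_nth_eq)
    \<comment> \<open>The differing component \<open>p\<close> falsifies the conjunction of equality
      tests, so the else branch is taken.\<close>
    have "\<exists>p\<in>{0..<length rs}. is ! p \<noteq> eval_exp s (is # env) (exp_of (rs ! p))"
      using p eval_exp_of_env[of s "is # env"] by force
    \<comment> \<open>The else branch rebuilds the index vector from \<open>length rs\<close>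
      components; equal lengths make this exactly \<open>is\<close>.\<close>
    moreover have "map (\<lambda>p. is ! p) [0..<length rs] = is"
      using len by (simp add: map_nth)
    ultimately show ?thesis
      using True by (auto simp: Let_def comp_def rec)
  qed (simp add: rec)
qed simp

lemma wf_rval_Lval:
  assumes "wf_rval ar r" and "(x, rs) \<in> Lval r"
  shows "wf_rval ar (Acc x rs)"
  using assms
proof (induction r)
  case (Bin f r1 r2)
  then show ?case
    by (metis Lval.simps(2) Un_iff wf_rval.simps(2))
next
  case (Acc y rs')
  from Acc(2,3) show ?case by simp
qed simp

text \<open>Well-formedness passes from right-hand sides to their top-level lvalues, and from
  lvalues to their indices.\<close>

lemma wf_rval_relevant:
  assumes "wf_loop ar T" and "l \<in> relevant T"
  shows "wf_rval ar (Acc (fst l) (snd l))"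
  using assms(2)
proof induction
  case (rhs l r l')
  then have "wf_rval ar r"
    using assms(1) by (auto simp: wf_loop_def)
  then show ?case
    using rhs(2) wf_rval_Lval by (metis prod.collapse)
next
  case (index x rs l')
  then obtain r where "r \<in> set rs" "l' \<in> Lval r" "wf_rval ar r"
    by (auto simp: Lvals_def)
  then show ?case
    using wf_rval_Lval by (metis prod.collapse)
qed

lemma wf_replace_lvals:
  assumes "\<And>l. l \<in> Lval r \<Longrightarrow> wf_exp (arity_n ar) [] (cf l)"
  shows "wf_exp (arity_n ar) [] (replace_lvals cf r)"
  using assms by (induction r) auto

lemma eval_replace_lvals:
  assumes "\<And>l. l \<in> Lval r \<Longrightarrow> closed_form ar T (cf l) l"
  shows "eval_exp (state_n s n) [] (replace_lvals cf r) = eval_exp ((step T ^^ n) s) [] (exp_of r)"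
  using assms by (induction r) (auto simp: closed_form_def eval_up_funpow)

lemma monotonic_step:
  assumes "monotonic T" and "(x, rs) \<in> set (lvalues T)" and "m \<le> n"
  shows "evals ((step T ^^ m) s) (map exp_of rs) \<le> evals ((step T ^^ n) s) (map exp_of rs)"
proof (rule lift_Suc_mono_le[OF _ assms(3)])
  fix k
  have "evals s' (map exp_of rs) \<le> evals (step T s') (map exp_of rs)" for s'
    using assms(1,2) unfolding monotonic_def by (simp add: comp_def eval_up)
  then show "evals ((step T ^^ k) s) (map exp_of rs) \<le> evals ((step T ^^ Suc k) s) (map exp_of rs)"
    by simp
qed

lemma displacing_step:
  assumes "displacing T (x, rs)" and "(x, rs') \<in> set (lvalues T)"
  shows "evals s (map exp_of rs') < evals (step T s) (map exp_of rs)"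
  using assms unfolding displacing_def by (simp add: comp_def eval_up)

lemma displaced_index_unchanged:
  assumes "wf_loop ar T" and "monotonic T" and "displacing T (x, rs)"
  shows "(step T ^^ n) s x (evals ((step T ^^ n) s) (map exp_of rs)) =
    s x (evals ((step T ^^ n) s) (map exp_of rs))"
proof -
  \<comment> \<open>The index is frozen at its value after all \<open>n\<close> steps, while the
    induction on \<open>k\<close> follows \<open>x\<close> at \<open>v\<close> from the initial
    state.\<close>
  define v where "v = evals ((step T ^^ n) s) (map exp_of rs)"
  have "(x, rs) \<in> relevant T"
    using assms(3) by (simp add: displacing_def)
  from wf_rval_relevant[OF assms(1) this] have len: "length v = ar x"
    by (simp add: v_def)
  have "(step T ^^ k) s x v = s x v" if "k \<le> n" for k
    using that
  proof (induction k)
    case (Suc k)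
    let ?s = "(step T ^^ k) s"
    have "length rs' = length v \<and> evals ?s (map exp_of rs') \<noteq> v"
      if lv: "(x, rs') \<in> fst ` set (assigns T)" for rs'
    proof
      show "length rs' = length v"
        using lv assms(1) len by (auto simp: wf_loop_def)
      have lv': "(x, rs') \<in> set (lvalues T)"
        using lv by simp
      \<comment> \<open>Displacement looks one step ahead, so it is applied to the last step, from
        \<open>m\<close> to \<open>n\<close>; monotonicity carries the index written in step
        \<open>k\<close> up to time \<open>m\<close>.\<close>
      obtain m where n: "n = Suc m"
        using Suc.prems by (cases n) auto
      have "evals ?s (map exp_of rs') \<le> evals ((step T ^^ m) s) (map exp_of rs')"
        using monotonic_step[OF assms(2) lv'] Suc.prems n by simp
      also have "\<dots> < v"
        using displacing_step[OF assms(3) lv', of "(step T ^^ m) s"] by (simp add: v_def n)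
      finally show "evals ?s (map exp_of rs') \<noteq> v"
        by simp
    qed
    then have "step T ?s x v = ?s x v"
      unfolding step_def by (rule eval_up_var_unchanged)
    then show ?case
      using Suc by simp
  qed simp
  then show ?thesis
    unfolding v_def by simp
qed

theorem theorem1:
  fixes ar :: "'v::countable \<Rightarrow> nat"
    and T :: "'v loop"
    and x :: 'v
    and rs :: "'v rval list"
    and cf :: "'v lval \<Rightarrow> 'v option exp"
  assumes "infinite (UNIV :: 'v set)"
    and "wf_loop ar T"
    and "monotonic T"
    and "(x, rs) \<in> relevant T"
    and "displacing T (x, rs)"
    and "\<And>l. l \<in> Lvals rs \<Longrightarrow> closed_form ar T (cf l) l"
  shows "closed_form ar T (ESel (EVar (Some x)) (map (replace_lvals cf) rs)) (x, rs)"
  unfolding closed_form_def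
proof (intro conjI allI)
  have cf: "closed_form ar T (cf l) l" if "r \<in> set rs" "l \<in> Lval r" for r l
    using that assms(6)[of l] unfolding Lvals_def by blast
  then have "wf_exp (arity_n ar) [] (replace_lvals cf r)" if "r \<in> set rs" for r
    using that by (intro wf_replace_lvals) (auto simp: closed_form_def)
  then show "wf_exp (arity_n ar) [] (ESel (EVar (Some x)) (map (replace_lvals cf) rs))"
    using wf_rval_relevant[OF assms(2,4)] by (simp add: arity_n_def)
next
  fix n and s :: "'v state"
  have "evals (state_n s n) (map (replace_lvals cf) rs) = evals ((step T ^^ n) s) (map exp_of rs)"
    using assms(6) by (auto simp: Lvals_def intro!: eval_replace_lvals)
  \<comment> \<open>Both sides now use the same index, but the left reads \<open>x\<close> in
    \<open>s\<close> and the right after \<open>n\<close> steps.\<close>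
  then show "eval_exp (state_n s n) [] (ESel (EVar (Some x)) (map (replace_lvals cf) rs)) =
      eval_exp s [] ((up T ^^ n) (exp_of_lval (x, rs)))"
    using displaced_index_unchanged[OF assms(2,3,5), of n s]
    by (simp add: eval_up_funpow state_n_def comp_def cong: map_cong)
qed

end
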